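(* For every $\Lambda>0$ there exists a positive radial solution $u$ of $$\Delta^3u=-\frac{1}{u^3}\quad\text{in }\mathbb{R}^3$$ such that $$\int_{\mathbb{R}^3}\frac{dx}{u^2(x)}=\Lambda.$$
   Context: Solutions are smooth functions defined on all of $\mathbb{R}^3$ (entire solutions). *)

theory Defs
  imports "HOL-Analysis.Analysis"
begin

fun Ck :: "nat \<Rightarrow> ('a::euclidean_space \<Rightarrow> real) \<Rightarrow> bool" where
  "Ck 0 f = continuous_on UNIV f"
| "Ck (Suc k) f = (f differentiable_on UNIV \<and>
      (\<forall>v. Ck k (\<lambda>x. frechet_derivative f (at x) v)))"

definition smooth :: "('a::euclidean_space \<Rightarrow> real) \<Rightarrow> bool" where
  "smooth f \<longleftrightarrow> (\<forall>k. Ck k f)"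

definition laplacian :: "('a::euclidean_space \<Rightarrow> real) \<Rightarrow> 'a \<Rightarrow> real" where
  "laplacian f x = (\<Sum>b\<in>Basis.
      frechet_derivative (\<lambda>y. frechet_derivative f (at y) b) (at x) b)"

definition radial :: "('a::real_normed_vector \<Rightarrow> real) \<Rightarrow> bool" where
  "radial f \<longleftrightarrow> (\<forall>x y. norm x = norm y \<longrightarrow> f x = f y)"

end

theory Submission
  imports Defs "HOL-Probability.Sinc_Integral"
begin

text \<open>
  The integral in question is invariant under the scaling of the equation, so for a coupling
  \<open>\<delta> > 0\<close> one may solve \<open>\<Delta>\<^sup>3 v = - \<delta> / v\<^sup>3\<close> instead, subject to \<open>\<surd>\<delta> \<integral> 1 / v\<^sup>2 = \<Lambda>\<close>. We look for \<open>v\<close> near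
  the well \<open>Q = \<eta>\<^sup>2 + (1 - \<bar>x\<bar>\<^sup>2)\<^sup>2\<close>, which satisfies \<open>\<Delta>\<^sup>3 Q = 0\<close> and concentrates on the unit sphere as
  \<open>\<eta> \<rightarrow> 0\<close>. There \<open>\<integral> 1 / Q\<^sup>2\<close> is at least of order \<open>\<eta>\<^sup>-\<^sup>3\<close>, so the constraint forces \<open>\<delta> = O(\<eta>\<^sup>6)\<close>,
  whereas the relevant mass of \<open>1 / Q\<^sup>3\<close> is only \<open>O(\<eta>\<^sup>-\<^sup>5)\<close>. Hence, with \<open>\<delta>\<close> determined by \<open>v\<close>, the
  correction is \<open>O(\<Lambda>\<^sup>2 \<eta>)\<close> relative to \<open>Q\<close>, and the fixed point problem for \<open>v / Q\<close> is a contraction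
  once \<open>\<eta>\<close> is small, whatever the value of \<open>\<Lambda>\<close>. Radial functions are written in the variable
  \<open>s = \<bar>x\<bar>\<^sup>2\<close>, in which the equation makes sense for all real \<open>s\<close>.
\<close>

section \<open>Smoothness and radial functions\<close>

lemma has_derivative_differentiable_on_UNIV:
  "(\<And>x. (f has_derivative f' x) (at x)) \<Longrightarrow> f differentiable_on UNIV"
  unfolding differentiable_on_def by (auto simp: differentiable_def)

lemma frechet_derivative_eqI:
  "(f has_derivative f') (at x) \<Longrightarrow> frechet_derivative f (at x) v = f' v"
  using frechet_derivative_at[of f f' x] by simp

lemma Ck_SucI:
  assumes "\<And>x. (f has_derivative f' x) (at x)" and "\<And>v. Ck k (\<lambda>x. f' x v)"
  shows "Ck (Suc k) f"
  using assms has_derivative_differentiable_on_UNIV[of f f']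
  by (simp add: frechet_derivative_eqI[OF assms(1)])

lemma Ck_Suc_has_derivative:
  assumes "Ck (Suc k) f"
  shows "\<exists>f'. (\<forall>x. (f has_derivative f' x) (at x)) \<and> (\<forall>v. Ck k (\<lambda>x. f' x v))"
proof (intro exI conjI allI)
  show "(f has_derivative frechet_derivative f (at x)) (at x)" for x
    using assms by (simp add: differentiable_on_def frechet_derivative_works[symmetric])
  show "Ck k (\<lambda>x. frechet_derivative f (at x) v)" for v
    using assms by simp
qed

lemma Ck_SucD: "Ck (Suc k) f \<Longrightarrow> Ck k f"
proof (induction k arbitrary: f)
  case 0
  then show ?case by (simp add: differentiable_imp_continuous_on)
next
  case (Suc k)
  obtain f' where f': "\<And>x. (f has_derivative f' x) (at x)" "\<And>v. Ck (Suc k) (\<lambda>x. f' x v)"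
    using Ck_Suc_has_derivative[OF Suc.prems] by blast
  show ?case by (rule Ck_SucI[OF f'(1)]) (intro Suc.IH f'(2))
qed

lemma Ck_const: "Ck k (\<lambda>x. c)"
proof (induction k arbitrary: c)
  case (Suc k)
  show ?case by (rule Ck_SucI[where f' = "\<lambda>x v. 0"]) (auto intro: Suc)
qed simp

lemma Ck_inner: "Ck k (\<lambda>x. x \<bullet> v)"
proof (cases k)
  case (Suc j)
  have "Ck (Suc j) (\<lambda>x. x \<bullet> v)"
    by (rule Ck_SucI[where f' = "\<lambda>x y. y \<bullet> v"]) (auto intro!: derivative_eq_intros Ck_const)
  then show ?thesis using Suc by simp
qed (auto intro: continuous_intros)

lemma Ck_add: "Ck k f \<Longrightarrow> Ck k g \<Longrightarrow> Ck k (\<lambda>x. f x + g x)"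
proof (induction k arbitrary: f g)
  case (Suc k)
  obtain f' where f': "\<And>x. (f has_derivative f' x) (at x)" "\<And>v. Ck k (\<lambda>x. f' x v)"
    using Ck_Suc_has_derivative[OF Suc.prems(1)] by blast
  obtain g' where g': "\<And>x. (g has_derivative g' x) (at x)" "\<And>v. Ck k (\<lambda>x. g' x v)"
    using Ck_Suc_has_derivative[OF Suc.prems(2)] by blast
  show ?case
    by (rule Ck_SucI[where f' = "\<lambda>x v. f' x v + g' x v"])
       (intro derivative_intros f' g' Suc.IH)+
qed (auto intro: continuous_intros)

lemma Ck_mult: "Ck k f \<Longrightarrow> Ck k g \<Longrightarrow> Ck k (\<lambda>x. f x * g x)"
proof (induction k arbitrary: f g)
  case (Suc k)
  obtain f' where f': "\<And>x. (f has_derivative f' x) (at x)" "\<And>v. Ck k (\<lambda>x. f' x v)"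
    using Ck_Suc_has_derivative[OF Suc.prems(1)] by blast
  obtain g' where g': "\<And>x. (g has_derivative g' x) (at x)" "\<And>v. Ck k (\<lambda>x. g' x v)"
    using Ck_Suc_has_derivative[OF Suc.prems(2)] by blast
  show ?case
    by (rule Ck_SucI[where f' = "\<lambda>x v. f x * g' x v + f' x v * g x"])
       (intro has_derivative_mult f' g' Suc.IH Ck_add Ck_SucD[OF Suc.prems(1)] Ck_SucD[OF Suc.prems(2)])+
qed (auto intro: continuous_intros)

lemma Ck_power: "Ck k f \<Longrightarrow> Ck k (\<lambda>x. f x ^ n)"
  by (induction n) (simp_all add: Ck_const Ck_mult)

lemma Ck_inverse: "Ck k f \<Longrightarrow> (\<And>x. f x \<noteq> 0) \<Longrightarrow> Ck k (\<lambda>x. inverse (f x))"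
proof (induction k)
  case (Suc k)
  obtain f' where f': "\<And>x. (f has_derivative f' x) (at x)" "\<And>v. Ck k (\<lambda>x. f' x v)"
    using Ck_Suc_has_derivative[OF Suc.prems(1)] by blast
  have inv: "Ck k (\<lambda>x. inverse (f x))"
    using Suc Ck_SucD by blast
  show ?case
  proof (rule Ck_SucI)
    show "((\<lambda>x. inverse (f x)) has_derivative (\<lambda>v. - 1 * (inverse (f x) * f' x v * inverse (f x)))) (at x)" for x
      using Deriv.has_derivative_inverse[OF Suc.prems(2) f'(1)] by simp
    show "Ck k (\<lambda>x. - 1 * (inverse (f x) * f' x v * inverse (f x)))" for v
      by (intro Ck_mult Ck_const inv f')
  qed
qed (auto intro: continuous_intros)

lemma Ck_Suc_realI:
  fixes f :: "real \<Rightarrow> real"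
  assumes "\<And>x. (f has_real_derivative f' x) (at x)" and "Ck k f'"
  shows "Ck (Suc k) f"
proof (rule Ck_SucI)
  show "(f has_derivative (*) (f' x)) (at x)" for x
    using assms(1) by (simp add: has_field_derivative_def)
  show "Ck k (\<lambda>x. f' x * v)" for v
    by (intro Ck_mult Ck_const assms(2))
qed

lemma Ck_Suc_has_real_derivative:
  fixes f :: "real \<Rightarrow> real"
  assumes "Ck (Suc k) f"
  shows "\<exists>f'. (\<forall>x. (f has_real_derivative f' x) (at x)) \<and> Ck k f'"
proof -
  obtain f' where f': "\<And>x. (f has_derivative f' x) (at x)" "\<And>v. Ck k (\<lambda>x. f' x v)"
    using Ck_Suc_has_derivative[OF assms] by blast
  have "f' x v = f' x 1 * v" for x v
    using linear_scale[OF has_derivative_linear[OF f'(1)[of x]], of v 1] by (simp add: mult.commute)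
  then have "(*) (f' x 1) = f' x" for x by (intro ext) (rule sym)
  then have "(f has_real_derivative f' x 1) (at x)" for x
    by (simp only: has_field_derivative_def f'(1))
  with f'(2)[of 1] show ?thesis by (intro exI[of _ "\<lambda>x. f' x 1"]) simp
qed

section \<open>Functions of the squared norm and their Laplacian\<close>

lemma radial_has_derivative:
  fixes F :: "real \<Rightarrow> real" and x :: "'a::euclidean_space"
  assumes "(F has_real_derivative F') (at (x \<bullet> x))"
  shows "((\<lambda>x. F (x \<bullet> x)) has_derivative (\<lambda>v. 2 * (x \<bullet> v) * F')) (at x)"
proof -
  have "((\<lambda>x. x \<bullet> x) has_derivative (\<lambda>v. 2 * (x \<bullet> v))) (at x)"
    by (auto intro!: derivative_eq_intros simp: inner_commute)
  from has_derivative_compose[OF this assms[unfolded has_field_derivative_def]]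
  show ?thesis by (simp add: mult.commute)
qed

lemma Ck_radial:
  fixes F :: "real \<Rightarrow> real"
  shows "Ck k F \<Longrightarrow> Ck k (\<lambda>x::'a::euclidean_space. F (x \<bullet> x))"
proof (induction k arbitrary: F)
  case 0
  then show ?case
    by (auto intro!: continuous_on_compose2[where f = "\<lambda>x. x \<bullet> x" and g = F] continuous_intros)
next
  case (Suc k)
  obtain F' where F': "\<And>x. (F has_real_derivative F' x) (at x)" "Ck k F'"
    using Ck_Suc_has_real_derivative[OF Suc.prems] by blast
  show ?case
  proof (rule Ck_SucI[OF radial_has_derivative[OF F'(1)]])
    show "Ck k (\<lambda>x::'a. 2 * (x \<bullet> v) * F' (x \<bullet> x))" for v
      by (intro Ck_mult Ck_const Ck_inner Suc.IH F'(2))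
  qed
qed

text \<open>Differentiating twice along a basis vector b gives 4 (x . b)^2 F'' + 2 F'; summing over
  the basis turns the squares into |x|^2.\<close>

lemma laplacian_radial:
  fixes F F' F'' :: "real \<Rightarrow> real" and x :: "'a::euclidean_space"
  assumes F': "\<And>s. (F has_real_derivative F' s) (at s)"
    and F'': "\<And>s. (F' has_real_derivative F'' s) (at s)"
  shows "laplacian (\<lambda>x::'a. F (x \<bullet> x)) x
    = 4 * (x \<bullet> x) * F'' (x \<bullet> x) + 2 * DIM('a) * F' (x \<bullet> x)"
proof -
  have 1: "frechet_derivative (\<lambda>x::'a. F (x \<bullet> x)) (at y) b = 2 * (y \<bullet> b) * F' (y \<bullet> y)" for y b
    by (rule frechet_derivative_eqI[OF radial_has_derivative[OF F']])
  have 2: "frechet_derivative (\<lambda>y. 2 * (y \<bullet> b) * F' (y \<bullet> y)) (at x) b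
      = 4 * (x \<bullet> b)\<^sup>2 * F'' (x \<bullet> x) + 2 * F' (x \<bullet> x)" if "b \<in> Basis" for b
  proof -
    have "((\<lambda>y. 2 * (y \<bullet> b) * F' (y \<bullet> y)) has_derivative
        (\<lambda>v. 2 * (x \<bullet> b) * (2 * (x \<bullet> v) * F'' (x \<bullet> x)) + 2 * (v \<bullet> b) * F' (x \<bullet> x))) (at x)"
      by (intro has_derivative_mult radial_has_derivative F'')
         (auto intro!: derivative_eq_intros)
    from frechet_derivative_eqI[OF this, of b] that show ?thesis
      by (simp add: inner_Basis power2_eq_square)
  qed
  have "laplacian (\<lambda>x::'a. F (x \<bullet> x)) x
    = (\<Sum>b\<in>Basis. 4 * (x \<bullet> b)\<^sup>2 * F'' (x \<bullet> x) + 2 * F' (x \<bullet> x))"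
    unfolding laplacian_def 1 by (intro sum.cong refl 2)
  also have "\<dots> = 4 * (\<Sum>b\<in>Basis. (x \<bullet> b)\<^sup>2) * F'' (x \<bullet> x) + 2 * DIM('a) * F' (x \<bullet> x)"
    by (simp add: sum.distrib sum_distrib_left sum_distrib_right)
  also have "(\<Sum>b\<in>Basis. (x \<bullet> b)\<^sup>2) = x \<bullet> x"
    by (simp add: euclidean_inner[of x x] power2_eq_square)
  finally show ?thesis .
qed

section \<open>Weighted radial means\<close>

text \<open>With s = r^2 this is r^(-j-1) times the integral of \<rho>^j f(\<rho>^2) over [0, r];
  for j = 2 it is the flux integral that inverts the radial Laplacian in three dimensions. In this
  form s = 0 is not singular and negative s is allowed.\<close>

definition radial_mean :: "nat \<Rightarrow> (real \<Rightarrow> real) \<Rightarrow> real \<Rightarrow> real" where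
  "radial_mean j f s = integral {0..1} (\<lambda>t. t ^ j * f (t\<^sup>2 * s))"

lemma continuous_on_radial_mean_integrand:
  fixes f :: "real \<Rightarrow> real"
  assumes "continuous_on UNIV f"
  shows "continuous_on A (\<lambda>t. t ^ j * f (t\<^sup>2 * s))"
  by (intro continuous_intros continuous_on_compose2[OF assms]) auto

lemma continuous_on_radial_mean:
  assumes "continuous_on UNIV f"
  shows "continuous_on UNIV (radial_mean j f)"
proof -
  have "continuous_on UNIV (\<lambda>s. integral (cbox 0 1) (\<lambda>t. t ^ j * f (t\<^sup>2 * s)))"
    by (rule integral_continuous_on_param)
       (auto simp: split_beta intro!: continuous_intros continuous_on_compose2[OF assms])
  then show ?thesis by (simp add: radial_mean_def[abs_def])
qed

lemma has_real_derivative_continuous_on: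
  fixes f :: "real \<Rightarrow> real"
  shows "(\<And>x. (f has_real_derivative f' x) (at x)) \<Longrightarrow> continuous_on A f"
  using DERIV_isCont by (intro continuous_at_imp_continuous_on) blast

text \<open>Differentiation under the integral sign: the chain rule produces a factor t^2, hence the
  weight index rises by 2.\<close>

lemma radial_mean_has_derivative:
  assumes f: "\<And>x. (f has_real_derivative f' x) (at x)" and f': "continuous_on UNIV f'"
  shows "(radial_mean j f has_real_derivative radial_mean (j + 2) f' s) (at s)"
proof -
  have c: "continuous_on UNIV f" using f by (rule has_real_derivative_continuous_on)
  have "((\<lambda>s. integral (cbox 0 1) (\<lambda>t. t ^ j * f (t\<^sup>2 * s))) has_real_derivative
    integral (cbox 0 1) (\<lambda>t. t ^ (j + 2) * f' (t\<^sup>2 * s))) (at s)"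
  proof (rule leibniz_rule_field_derivative[where U = UNIV])
    show "((\<lambda>x. t ^ j * f (t\<^sup>2 * x)) has_real_derivative t ^ (j + 2) * f' (t\<^sup>2 * x)) (at x)" for x t
      by (auto intro!: derivative_eq_intros DERIV_chain2[OF f] simp: power_add power2_eq_square)
    show "(\<lambda>t. t ^ j * f (t\<^sup>2 * x)) integrable_on cbox 0 1" for x
      by (intro integrable_continuous continuous_on_radial_mean_integrand c)
    show "continuous_on (UNIV \<times> cbox 0 1) (\<lambda>(x, t). t ^ (j + 2) * f' (t\<^sup>2 * x))"
      by (auto simp: split_beta intro!: continuous_intros continuous_on_compose2[OF f'])
  qed auto
  then show ?thesis by (simp add: radial_mean_def[abs_def])
qed

lemma Ck_imp_continuous: "Ck k f \<Longrightarrow> continuous_on UNIV f"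
proof (induction k)
  case (Suc k)
  then show ?case using Ck_SucD by blast
qed simp

lemma Ck_radial_mean: "Ck k f \<Longrightarrow> Ck k (radial_mean j f)"
proof (induction k arbitrary: f j)
  case 0
  then show ?case by (simp add: continuous_on_radial_mean)
next
  case (Suc k)
  obtain f' where f': "\<And>x. (f has_real_derivative f' x) (at x)" "Ck k f'"
    using Ck_Suc_has_real_derivative[OF Suc.prems] by blast
  show ?case
    by (rule Ck_Suc_realI[OF radial_mean_has_derivative[OF f'(1) Ck_imp_continuous[OF f'(2)]]])
       (rule Suc.IH[OF f'(2)])
qed

lemma radial_mean_diff:
  assumes "continuous_on UNIV f" "continuous_on UNIV g"
  shows "radial_mean j (\<lambda>x. f x - g x) s = radial_mean j f s - radial_mean j g s"
  unfolding radial_mean_def right_diff_distrib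
  by (intro integral_diff integrable_continuous_real continuous_on_radial_mean_integrand assms)

lemma radial_mean_cmult: "radial_mean j (\<lambda>x. c * f x) s = c * radial_mean j f s"
  unfolding radial_mean_def by (simp add: mult.left_commute)

lemma radial_mean_const: "radial_mean j (\<lambda>x. c) s = c / (j + 1)"
proof -
  have "((\<lambda>t::real. t ^ j * c) has_integral (1 ^ Suc j * c / (j + 1) - 0 ^ Suc j * c / (j + 1))) {0..1}"
  proof (rule fundamental_theorem_of_calculus)
    fix t :: real
    have "((\<lambda>t. t ^ Suc j * c / (j + 1)) has_real_derivative t ^ j * c) (at t within {0..1})"
      by (rule derivative_eq_intros refl | simp)+
    then show "((\<lambda>t. t ^ Suc j * c / (j + 1)) has_vector_derivative t ^ j * c) (at t within {0..1})"
      by (simp add: has_real_derivative_iff_has_vector_derivative)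
  qed simp
  from integral_unique[OF this] show ?thesis by (simp add: radial_mean_def)
qed

lemma radial_mean_abs_le:
  assumes "continuous_on UNIV f" and "\<And>x. \<bar>f x\<bar> \<le> B"
  shows "\<bar>radial_mean j f s\<bar> \<le> B"
proof -
  have "norm (integral {0..1} (\<lambda>t. t ^ j * f (t\<^sup>2 * s))) \<le> B * (1 - 0)"
  proof (rule integral_bound)
    fix t :: real assume "t \<in> {0..1}"
    then have "\<bar>t ^ j\<bar> \<le> 1" by (auto simp: power_le_one)
    then have "\<bar>t ^ j\<bar> * \<bar>f (t\<^sup>2 * s)\<bar> \<le> 1 * B" using assms(2) by (intro mult_mono) auto
    then show "norm (t ^ j * f (t\<^sup>2 * s)) \<le> B" by (simp add: abs_mult)
  qed (simp_all add: continuous_on_radial_mean_integrand assms(1))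
  then show ?thesis by (simp add: radial_mean_def)
qed

text \<open>
  If \<open>F' = \<onehalf> radial_mean 2 G\<close> then \<open>x \<mapsto> F (x \<bullet> x)\<close> has Laplacian \<open>G (x \<bullet> x)\<close> in three
  dimensions: the integrand below is the derivative of \<open>t \<mapsto> t\<^sup>3 G (t\<^sup>2 s)\<close>.
\<close>
lemma radial_mean_laplacian:
  assumes G: "\<And>x. (G has_real_derivative G' x) (at x)" and G': "continuous_on UNIV G'"
  shows "2 * s * radial_mean 4 G' s + 3 * radial_mean 2 G s = G s"
proof -
  have c: "continuous_on UNIV G" using G by (rule has_real_derivative_continuous_on)
  have "((\<lambda>t. 2 * s * (t ^ 4 * G' (t\<^sup>2 * s)) + 3 * (t\<^sup>2 * G (t\<^sup>2 * s))) has_integral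
     1 ^ 3 * G (1\<^sup>2 * s) - 0 ^ 3 * G (0\<^sup>2 * s)) {0..1}"
  proof (rule fundamental_theorem_of_calculus)
    fix t :: real
    have "((\<lambda>t. t ^ 3 * G (t\<^sup>2 * s)) has_real_derivative
       2 * s * (t ^ 4 * G' (t\<^sup>2 * s)) + 3 * (t\<^sup>2 * G (t\<^sup>2 * s))) (at t)"
      by (auto intro!: derivative_eq_intros DERIV_chain2[OF G] simp: algebra_simps eval_nat_numeral)
    then show "((\<lambda>t. t ^ 3 * G (t\<^sup>2 * s)) has_vector_derivative
       2 * s * (t ^ 4 * G' (t\<^sup>2 * s)) + 3 * (t\<^sup>2 * G (t\<^sup>2 * s))) (at t within {0..1})"
      by (simp add: has_real_derivative_iff_has_vector_derivative has_vector_derivative_at_within)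
  qed auto
  then have "integral {0..1} (\<lambda>t. 2 * s * (t ^ 4 * G' (t\<^sup>2 * s)) + 3 * (t\<^sup>2 * G (t\<^sup>2 * s))) = G s"
    by (simp add: integral_unique)
  moreover have "integral {0..1} (\<lambda>t. 2 * s * (t ^ 4 * G' (t\<^sup>2 * s)) + 3 * (t\<^sup>2 * G (t\<^sup>2 * s)))
    = integral {0..1} (\<lambda>t. 2 * s * (t ^ 4 * G' (t\<^sup>2 * s))) + integral {0..1} (\<lambda>t. 3 * (t\<^sup>2 * G (t\<^sup>2 * s)))"
    by (intro integral_add integrable_continuous_real continuous_intros
        continuous_on_compose2[OF c] continuous_on_compose2[OF G']) auto
  ultimately show ?thesis by (simp add: radial_mean_def)
qed

section \<open>Signed primitives with a base point\<close>

text \<open>One of the two integrals is always over an empty or one-point interval, so this is the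
  oriented integral from a to x on either side of a.\<close>

definition primitive :: "real \<Rightarrow> (real \<Rightarrow> real) \<Rightarrow> real \<Rightarrow> real" where
  "primitive a f x = integral {a..x} f - integral {x..a} f"

lemma primitive_self [simp]: "primitive a f a = 0"
  by (simp add: primitive_def)

lemma primitive_has_derivative:
  assumes f: "continuous_on UNIV f"
  shows "(primitive a f has_real_derivative f x) (at x)"
proof -
  \<comment> \<open>An interval with a and x in its interior, so that one formula covers both orders
    of a and the points near x.\<close>
  define l u where "l = min a x - 1" and "u = max a x + 1"
  have int: "f integrable_on {p..q}" for p q
    using f by (intro integrable_continuous_real) (auto intro: continuous_on_subset)
  have eq: "integral {l..y} f - integral {l..a} f = primitive a f y" if "y \<in> {l<..<u}" for y
  proof (cases "a \<le> y")
    case True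
    then have "integral {l..a} f + integral {a..y} f = integral {l..y} f"
      by (intro Henstock_Kurzweil_Integration.integral_combine int) (auto simp: l_def)
    moreover have "integral {y..a} f = 0" using True by (cases "a = y") auto
    ultimately show ?thesis by (simp add: primitive_def)
  next
    case False
    then have "integral {l..y} f + integral {y..a} f = integral {l..a} f"
      using that by (intro Henstock_Kurzweil_Integration.integral_combine int) auto
    then show ?thesis using False by (simp add: primitive_def)
  qed
  have x: "x \<in> {l<..<u}" by (auto simp: l_def u_def)
  have "((\<lambda>y. integral {l..y} f) has_real_derivative f x) (at x within {l..u})"
    using x by (intro integral_has_real_derivative continuous_on_subset[OF f]) auto
  then have "((\<lambda>y. integral {l..y} f) has_real_derivative f x) (at x within {l<..<u})"
    by (rule DERIV_subset) auto
  then have "((\<lambda>y. integral {l..y} f) has_real_derivative f x) (at x)"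
    using x by (simp add: at_within_open[OF x])
  then have "((\<lambda>y. integral {l..y} f - integral {l..a} f) has_real_derivative f x) (at x)"
    by (auto intro!: derivative_eq_intros)
  then show ?thesis
    by (rule has_field_derivative_transform_within_open[where S = "{l<..<u}"]) (use x eq in auto)
qed

lemma continuous_on_primitive: "continuous_on UNIV f \<Longrightarrow> continuous_on A (primitive a f)"
  using has_real_derivative_continuous_on primitive_has_derivative by blast

lemma primitive_diff:
  assumes "continuous_on UNIV f" "continuous_on UNIV g"
  shows "primitive a (\<lambda>x. f x - g x) s = primitive a f s - primitive a g s"
proof -
  have "h integrable_on {p..q}" if "continuous_on UNIV h" for h :: "real \<Rightarrow> real" and p q
    using that by (intro integrable_continuous_real) (auto intro: continuous_on_subset)
  then show ?thesis using assms by (simp add: primitive_def integral_diff)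
qed

text \<open>Only values of \<open>f\<close> no farther from a than x enter, which lets the estimate
  be iterated to a quadratic bound.\<close>

lemma primitive_abs_le:
  assumes f: "continuous_on UNIV f" and B: "\<And>y. \<bar>y - a\<bar> \<le> \<bar>x - a\<bar> \<Longrightarrow> \<bar>f y\<bar> \<le> B"
  shows "\<bar>primitive a f x\<bar> \<le> B * \<bar>x - a\<bar>"
proof (cases "a \<le> x")
  case True
  have "norm (integral {a..x} f) \<le> B * (x - a)"
    using True by (intro integral_bound continuous_on_subset[OF f]) (auto intro!: B)
  moreover have "integral {x..a} f = 0" using True by (cases "a = x") auto
  ultimately show ?thesis using True by (simp add: primitive_def)
next
  case False
  have "norm (integral {x..a} f) \<le> B * (a - x)"
    using False by (intro integral_bound continuous_on_subset[OF f]) (auto intro!: B)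
  then show ?thesis using False by (simp add: primitive_def)
qed

text \<open>Both the difference and the sum of \<open>G\<close> and \<open>primitive a f\<close> are
  nondecreasing. The bound is uniform in x when \<open>G\<close> is bounded.\<close>

lemma primitive_abs_le_primitive:
  assumes f: "continuous_on UNIV f" and G: "\<And>y. (G has_real_derivative G' y) (at y)"
    and le: "\<And>y. \<bar>f y\<bar> \<le> G' y"
  shows "\<bar>primitive a f x\<bar> \<le> \<bar>G x - G a\<bar>"
proof -
  have p: "(primitive a f has_real_derivative f y) (at y)" for y
    by (rule primitive_has_derivative[OF f])
  have mono1: "G y - primitive a f y \<le> G z - primitive a f z" if "y \<le> z" for y z
  proof (rule DERIV_nonneg_imp_nondecreasing[OF that])
    fix t
    have "0 \<le> G' t - f t" using le[of t] by (simp add: abs_le_iff)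
    then show "\<exists>d. ((\<lambda>t. G t - primitive a f t) has_real_derivative d) (at t) \<and> 0 \<le> d"
      using DERIV_diff[OF G p] by blast
  qed
  have mono2: "G y + primitive a f y \<le> G z + primitive a f z" if "y \<le> z" for y z
  proof (rule DERIV_nonneg_imp_nondecreasing[OF that])
    fix t
    have "0 \<le> G' t + f t" using le[of t] by (simp add: abs_le_iff)
    then show "\<exists>d. ((\<lambda>t. G t + primitive a f t) has_real_derivative d) (at t) \<and> 0 \<le> d"
      using DERIV_add[OF G p] by blast
  qed
  show ?thesis
    using mono1[of a x] mono2[of a x] mono1[of x a] mono2[of x a] by (cases "a \<le> x") auto
qed

section \<open>The linear problem and the well\<close>

text \<open>
  In the variable \<open>s = \<bar>x\<bar>\<^sup>2\<close>, \<open>potential k\<close> is a solution of \<open>\<Delta>\<^sup>3 H = - k\<close>. Its free constants are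
  chosen so that \<open>H\<close> vanishes to second order at \<open>s = 1\<close>, where the well has its bottom; this is
  what makes \<open>H\<close> small relative to the well, uniformly in \<open>s\<close>.
\<close>
definition potential :: "(real \<Rightarrow> real) \<Rightarrow> real \<Rightarrow> real" where
  "potential k = primitive 1 (primitive 1 (\<lambda>s. 1 / 4 *
     radial_mean 4 (radial_mean 2 (\<lambda>y. - 1 / 2 * radial_mean 0 (primitive 0 k) y)) s))"

lemmas continuous_on_potential_parts =
  continuous_on_mult continuous_on_const continuous_on_primitive continuous_on_radial_mean

lemma continuous_on_potential:
  "continuous_on UNIV k \<Longrightarrow> continuous_on UNIV (potential k)"
  unfolding potential_def by (intro continuous_on_potential_parts)

text \<open>Every layer of \<open>potential\<close> is linear on continuous functions, so the
  difference is pushed outward one layer at a time.\<close>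

lemma potential_diff:
  assumes k: "continuous_on UNIV k" and l: "continuous_on UNIV l"
  shows "potential (\<lambda>s. k s - l s) s = potential k s - potential l s"
proof -
  have 0: "primitive 0 (\<lambda>s. k s - l s) = (\<lambda>s. primitive 0 k s - primitive 0 l s)"
    by (intro ext primitive_diff k l)
  have 1: "radial_mean 0 (\<lambda>s. primitive 0 k s - primitive 0 l s)
      = (\<lambda>s. radial_mean 0 (primitive 0 k) s - radial_mean 0 (primitive 0 l) s)"
    by (intro ext radial_mean_diff continuous_on_primitive k l)
  have 2: "radial_mean 2 (\<lambda>s. - 1 / 2 * radial_mean 0 (primitive 0 k) s - - 1 / 2 * radial_mean 0 (primitive 0 l) s)
      = (\<lambda>s. radial_mean 2 (\<lambda>s. - 1 / 2 * radial_mean 0 (primitive 0 k) s) s - radial_mean 2 (\<lambda>s. - 1 / 2 * radial_mean 0 (primitive 0 l) s) s)"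
    by (intro ext radial_mean_diff continuous_on_potential_parts k l)
  have 3: "radial_mean 4 (\<lambda>s. radial_mean 2 (\<lambda>s. - 1 / 2 * radial_mean 0 (primitive 0 k) s) s - radial_mean 2 (\<lambda>s. - 1 / 2 * radial_mean 0 (primitive 0 l) s) s)
    = (\<lambda>s. radial_mean 4 (radial_mean 2 (\<lambda>s. - 1 / 2 * radial_mean 0 (primitive 0 k) s)) s - radial_mean 4 (radial_mean 2 (\<lambda>s. - 1 / 2 * radial_mean 0 (primitive 0 l) s)) s)"
    by (intro ext radial_mean_diff continuous_on_potential_parts k l)
  define p where "p k = (\<lambda>s. 1 / 4 * radial_mean 4 (radial_mean 2 (\<lambda>s. - 1 / 2 * radial_mean 0 (primitive 0 k) s)) s)"
    for k :: "real \<Rightarrow> real"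
  have p: "continuous_on UNIV (p k)" "continuous_on UNIV (p l)"
    unfolding p_def by (intro continuous_on_potential_parts k l)+
  have "p (\<lambda>s. k s - l s) = (\<lambda>s. p k s - p l s)"
    unfolding p_def 0 1 right_diff_distrib 2 3 by (rule refl)
  moreover have "primitive 1 (\<lambda>s. p k s - p l s) = (\<lambda>s. primitive 1 (p k) s - primitive 1 (p l) s)"
    by (intro ext primitive_diff p)
  moreover have "primitive 1 (\<lambda>s. primitive 1 (p k) s - primitive 1 (p l) s) s
      = primitive 1 (primitive 1 (p k)) s - primitive 1 (primitive 1 (p l)) s"
    by (intro primitive_diff continuous_on_primitive p)
  ultimately show ?thesis
    unfolding potential_def p_def[symmetric] by simp
qed

text \<open>With Q = \<eta>^2 + (1 - s)^2, 1/Q^3 is at most 1/(\<eta>^4 Q), and C/(\<eta>^4 Q) has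
  an arctan primitive of total size C/\<eta>^5; this bounds the innermost primitive. The means do
  not enlarge a bound, and the two primitives based at 1 contribute (1 - s)^2.\<close>

lemma potential_abs_le:
  assumes k: "continuous_on UNIV k" and eta: "0 < \<eta>" and C: "0 \<le> C"
    and le: "\<And>s. \<bar>k s\<bar> \<le> C / (\<eta>\<^sup>2 + (1 - s)\<^sup>2) ^ 3"
  shows "\<bar>potential k s\<bar> \<le> C / \<eta> ^ 5 * (1 - s)\<^sup>2"
proof -
  define K where "K = C / \<eta> ^ 5"
  have K: "0 \<le> K" using C eta by (simp add: K_def)
  have prim: "\<bar>primitive 0 k y\<bar> \<le> 4 * K" for y
  proof -
    have deriv: "((\<lambda>s. K * arctan ((s - 1) / \<eta>)) has_real_derivative
        C / (\<eta> ^ 4 * (\<eta>\<^sup>2 + (1 - t)\<^sup>2))) (at t)" for t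
    proof -
      have pos: "\<eta>\<^sup>2 + (1 - t)\<^sup>2 > 0" using eta by (intro add_pos_nonneg) auto
      have "1 + ((t - 1) / \<eta>)\<^sup>2 = (\<eta>\<^sup>2 + (1 - t)\<^sup>2) / \<eta>\<^sup>2"
        using eta by (simp add: field_simps power2_commute)
      then have "K * (inverse (1 + ((t - 1) / \<eta>)\<^sup>2) * (1 / \<eta>)) = C / (\<eta> ^ 4 * (\<eta>\<^sup>2 + (1 - t)\<^sup>2))"
        using eta pos by (simp add: K_def field_simps eval_nat_numeral)
      moreover have "((\<lambda>s. K * arctan ((s - 1) / \<eta>)) has_real_derivative
         K * (inverse (1 + ((t - 1) / \<eta>)\<^sup>2) * (1 / \<eta>))) (at t)"
        using eta by (auto intro!: derivative_eq_intros)
      ultimately show ?thesis by simp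
    qed
    have "\<bar>k t\<bar> \<le> C / (\<eta> ^ 4 * (\<eta>\<^sup>2 + (1 - t)\<^sup>2))" for t
    proof -
      have pos: "\<eta>\<^sup>2 + (1 - t)\<^sup>2 > 0" using eta by (intro add_pos_nonneg) auto
      have "(\<eta>\<^sup>2)\<^sup>2 \<le> (\<eta>\<^sup>2 + (1 - t)\<^sup>2)\<^sup>2"
        by (intro power_mono) auto
      then have "\<eta> ^ 4 * (\<eta>\<^sup>2 + (1 - t)\<^sup>2) \<le> (\<eta>\<^sup>2 + (1 - t)\<^sup>2)\<^sup>2 * (\<eta>\<^sup>2 + (1 - t)\<^sup>2)"
        using pos by (intro mult_right_mono) auto
      also have "\<dots> = (\<eta>\<^sup>2 + (1 - t)\<^sup>2) ^ 3" by (simp add: power3_eq_cube power2_eq_square)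
      finally have "C / (\<eta>\<^sup>2 + (1 - t)\<^sup>2) ^ 3 \<le> C / (\<eta> ^ 4 * (\<eta>\<^sup>2 + (1 - t)\<^sup>2))"
        using C eta pos by (intro divide_left_mono) auto
      with le[of t] show ?thesis by simp
    qed
    from primitive_abs_le_primitive[OF k deriv this, of 0 y]
    have "\<bar>primitive 0 k y\<bar> \<le> K * \<bar>arctan ((y - 1) / \<eta>) - arctan ((0 - 1) / \<eta>)\<bar>"
      using K by (simp add: abs_mult flip: right_diff_distrib)
    also have "\<dots> \<le> K * 4"
    proof (rule mult_left_mono[OF _ K])
      have "\<bar>arctan z\<bar> \<le> 2" for z using arctan_bounded[of z] pi_less_4 by auto
      then have "\<bar>arctan ((y - 1) / \<eta>)\<bar> \<le> 2" "\<bar>arctan ((0 - 1) / \<eta>)\<bar> \<le> 2" by blast+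
      then show "\<bar>arctan ((y - 1) / \<eta>) - arctan ((0 - 1) / \<eta>)\<bar> \<le> 4" by linarith
    qed
    finally show ?thesis by simp
  qed
  have "\<bar>radial_mean 0 (primitive 0 k) y\<bar> \<le> 4 * K" for y
    by (intro radial_mean_abs_le continuous_on_primitive k prim)
  then have w: "\<bar>- 1 / 2 * radial_mean 0 (primitive 0 k) y\<bar> \<le> 2 * K" for y
    by (simp add: abs_mult field_simps)
  have m: "\<bar>radial_mean 4 (radial_mean 2 (\<lambda>y. - 1 / 2 * radial_mean 0 (primitive 0 k) y)) y\<bar> \<le> 2 * K" for y
    by (intro radial_mean_abs_le continuous_on_potential_parts k w)
  define p where "p = (\<lambda>s. 1 / 4 * radial_mean 4 (radial_mean 2 (\<lambda>s. - 1 / 2 * radial_mean 0 (primitive 0 k) s)) s)"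
  have p: "\<bar>p y\<bar> \<le> K" for y
  proof -
    have "\<bar>p y\<bar> = \<bar>radial_mean 4 (radial_mean 2 (\<lambda>y. - 1 / 2 * radial_mean 0 (primitive 0 k) y)) y\<bar> / 4"
      unfolding p_def by (simp only: abs_mult)
    with m[of y] K show ?thesis by linarith
  qed
  have pc: "continuous_on UNIV p"
    unfolding p_def by (intro continuous_on_potential_parts k)
  have "\<bar>primitive 1 (primitive 1 p) s\<bar> \<le> (K * \<bar>s - 1\<bar>) * \<bar>s - 1\<bar>"
  proof (rule primitive_abs_le)
    fix y assume y: "\<bar>y - 1\<bar> \<le> \<bar>s - 1\<bar>"
    have "\<bar>primitive 1 p y\<bar> \<le> K * \<bar>y - 1\<bar>"
      by (intro primitive_abs_le pc p)
    also have "\<dots> \<le> K * \<bar>s - 1\<bar>" using y K by (rule mult_left_mono)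
    finally show "\<bar>primitive 1 p y\<bar> \<le> K * \<bar>s - 1\<bar>" .
  qed (intro continuous_on_primitive pc)
  also have "\<dots> = K * (1 - s)\<^sup>2"
    by (simp add: power2_eq_square flip: abs_mult) (simp add: algebra_simps)
  finally show ?thesis by (simp add: potential_def p_def K_def)
qed

section \<open>The volume integral of functions close to the well\<close>

text \<open>Each 1 + (x . b)^2 is at most 1 + |x|^2, so the integrand is dominated by a product of
  three one-dimensional factors 1/(1 + t^2), and Tonelli applies.\<close>

lemma integrable_inverse_one_plus_inner_cubed:
  "integrable lborel (\<lambda>x::real^3. 1 / (1 + x \<bullet> x) ^ 3)"
proof (rule integrableI_bounded)
  have 1: "nn_integral lborel (\<lambda>t::real. ennreal (1 / (1 + t\<^sup>2))) < \<infinity>"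
    using integrable_inverse_1_plus_square
    by (auto simp: set_integrable_def integrable_iff_bounded einterval_def inverse_eq_divide)
  have "nn_integral lborel (\<lambda>x::real^3. ennreal (norm (1 / (1 + x \<bullet> x) ^ 3)))
     \<le> nn_integral lborel (\<lambda>x::real^3. \<Prod>b\<in>Basis. ennreal (1 / (1 + (x \<bullet> b)\<^sup>2)))"
  proof (rule nn_integral_mono)
    fix x :: "real^3"
    have "(\<Prod>b\<in>Basis. 1 + (x \<bullet> b)\<^sup>2) \<le> (\<Prod>b\<in>(Basis :: (real^3) set). 1 + x \<bullet> x)"
    proof (rule prod_mono)
      fix b :: "real^3" assume b: "b \<in> Basis"
      have "(x \<bullet> b)\<^sup>2 \<le> (x \<bullet> x) * (b \<bullet> b)" by (rule Cauchy_Schwarz_ineq)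
      then show "0 \<le> 1 + (x \<bullet> b)\<^sup>2 \<and> 1 + (x \<bullet> b)\<^sup>2 \<le> 1 + x \<bullet> x"
        using b by (simp add: inner_Basis)
    qed
    then have le: "(\<Prod>b\<in>Basis. 1 + (x \<bullet> b)\<^sup>2) \<le> (1 + x \<bullet> x) ^ 3" by simp
    have pos: "0 < (\<Prod>b\<in>Basis. 1 + (x \<bullet> b)\<^sup>2)"
      by (intro prod_pos) (simp add: add_pos_nonneg)
    have "1 / (1 + x \<bullet> x) ^ 3 \<le> 1 / (\<Prod>b\<in>Basis. 1 + (x \<bullet> b)\<^sup>2)"
      using le pos by (intro divide_left_mono) (auto simp: add_pos_nonneg)
    also have "\<dots> = (\<Prod>b\<in>Basis. 1 / (1 + (x \<bullet> b)\<^sup>2))" by (simp add: prod_dividef)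
    finally show "ennreal (norm (1 / (1 + x \<bullet> x) ^ 3)) \<le> (\<Prod>b\<in>Basis. ennreal (1 / (1 + (x \<bullet> b)\<^sup>2)))"
      by (simp add: prod_ennreal ennreal_leI)
  qed
  also have "\<dots> = (\<Prod>b\<in>(Basis :: (real^3) set). nn_integral lborel (\<lambda>t. ennreal (1 / (1 + t\<^sup>2))))"
    by (rule nn_integral_lborel_prod) auto
  also have "\<dots> < \<infinity>"
    using 1 by (simp add: power_less_top_ennreal)
  finally show "nn_integral lborel (\<lambda>x::real^3. ennreal (norm (1 / (1 + x \<bullet> x) ^ 3))) < \<infinity>" .
qed simp

text \<open>For u(x) = V(|x|^2), this is the volume of R^3 in the conformal metric u^(-4/3)
  |dx|^2.\<close>

definition conformal_volume :: "(real \<Rightarrow> real) \<Rightarrow> real" where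
  "conformal_volume V = (LINT x::real^3|lborel. 1 / (V (x \<bullet> x))\<^sup>2)"

text \<open>The relative deviation from the well is at most 1/2. The bounds are imposed for all real
  s because the fixed point space consists of functions on the whole line.\<close>

definition near_well :: "real \<Rightarrow> (real \<Rightarrow> real) \<Rightarrow> bool" where
  "near_well \<eta> V \<longleftrightarrow> continuous_on UNIV V \<and>
     (\<forall>s. (\<eta>\<^sup>2 + (1 - s)\<^sup>2) / 2 \<le> V s \<and> V s \<le> 3 / 2 * (\<eta>\<^sup>2 + (1 - s)\<^sup>2))"

lemma near_well_continuous: "near_well \<eta> V \<Longrightarrow> continuous_on UNIV V"
  by (simp add: near_well_def)

lemma near_wellD:
  assumes "near_well \<eta> V" "0 < \<eta>"
  shows "(\<eta>\<^sup>2 + (1 - s)\<^sup>2) / 2 \<le> V s" "V s \<le> 3 / 2 * (\<eta>\<^sup>2 + (1 - s)\<^sup>2)"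
    and "0 < \<eta>\<^sup>2 + (1 - s)\<^sup>2" "0 < V s"
proof -
  show *: "0 < \<eta>\<^sup>2 + (1 - s)\<^sup>2" using assms(2) by (intro add_pos_nonneg) auto
  show le: "(\<eta>\<^sup>2 + (1 - s)\<^sup>2) / 2 \<le> V s" and "V s \<le> 3 / 2 * (\<eta>\<^sup>2 + (1 - s)\<^sup>2)"
    using assms(1) by (auto simp: near_well_def)
  show "0 < V s" by (rule less_le_trans[OF _ le]) (use * in simp)
qed

lemma borel_measurable_radial:
  fixes V :: "real \<Rightarrow> real"
  assumes "continuous_on UNIV V"
  shows "(\<lambda>x::'a::euclidean_space. V (x \<bullet> x)) \<in> borel_measurable borel"
  by (intro borel_measurable_continuous_onI continuous_on_compose2[OF assms]) (auto intro: continuous_intros)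

text \<open>The well dominates a multiple, depending on \<eta>, of (1 + s)^2, so 1/V^2 decays at
  least like (1 + s)^(-4) with s = |x|^2.\<close>

lemma integrable_conformal_volume:
  assumes V: "near_well \<eta> V" and eta: "0 < \<eta>"
  shows "integrable lborel (\<lambda>x::real^3. 1 / (V (x \<bullet> x))\<^sup>2)"
proof (rule Bochner_Integration.integrable_bound)
  define c where "c = 4 * (2 + 8 / \<eta>\<^sup>2)\<^sup>2"
  show "integrable lborel (\<lambda>x::real^3. c * (1 / (1 + x \<bullet> x) ^ 3))"
    by (intro integrable_mult_right integrable_inverse_one_plus_inner_cubed)
  note W = near_wellD[OF V eta]
  have [measurable]: "(\<lambda>x::real^3. V (x \<bullet> x)) \<in> borel_measurable borel"
    by (rule borel_measurable_radial[OF near_well_continuous[OF V]])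
  show "(\<lambda>x::real^3. 1 / (V (x \<bullet> x))\<^sup>2) \<in> borel_measurable lborel" by measurable
  have "1 / (V s)\<^sup>2 \<le> c * (1 / (1 + s) ^ 3)" if "0 \<le> s" for s
  proof -
    let ?Q = "\<eta>\<^sup>2 + (1 - s)\<^sup>2"
    \<comment> \<open>The constants 2 and 8 come from completing a square: the two sides differ by
      (s - 3)^2.\<close>
    have "(1 + s)\<^sup>2 \<le> 2 * (1 - s)\<^sup>2 + 8"
    proof -
      have "2 * (1 - s)\<^sup>2 + 8 - (1 + s)\<^sup>2 = (s - 3)\<^sup>2" by (simp add: power2_eq_square algebra_simps)
      then show ?thesis by (metis zero_le_power2 diff_ge_0_iff_ge)
    qed
    also have "\<dots> \<le> (2 + 8 / \<eta>\<^sup>2) * ?Q"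
    proof -
      have "(2 + 8 / \<eta>\<^sup>2) * ?Q = 2 * \<eta>\<^sup>2 + 2 * (1 - s)\<^sup>2 + 8 + 8 / \<eta>\<^sup>2 * (1 - s)\<^sup>2"
        using eta by (simp add: field_simps)
      moreover have "0 \<le> 8 / \<eta>\<^sup>2 * (1 - s)\<^sup>2" by simp
      moreover have "0 \<le> \<eta>\<^sup>2" by simp
      ultimately show ?thesis by linarith
    qed
    also have "\<dots> \<le> (2 + 8 / \<eta>\<^sup>2) * (2 * V s)"
      using W(1)[of s] by (intro mult_left_mono) auto
    finally have "((1 + s)\<^sup>2)\<^sup>2 \<le> ((2 + 8 / \<eta>\<^sup>2) * (2 * V s))\<^sup>2"
      by (intro power_mono) auto
    then have 4: "(1 + s) ^ 4 \<le> c * (V s)\<^sup>2" by (simp add: c_def power_mult_distrib)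
    have "(1 + s) ^ 3 \<le> (1 + s) ^ 4" using that by (intro power_increasing) auto
    with 4 have "(1 + s) ^ 3 \<le> c * (V s)\<^sup>2" by linarith
    then show ?thesis using that W(4)[of s] by (simp add: divide_simps)
  qed
  moreover have "0 \<le> c" by (simp add: c_def)
  ultimately show "AE x::real^3 in lborel. norm (1 / (V (x \<bullet> x))\<^sup>2) \<le> norm (c * (1 / (1 + x \<bullet> x) ^ 3))"
    by (intro AE_I2) simp
qed

text \<open>The shell 1 \<le> |x| < 1 + \<eta> has volume at least \<eta>. On it 1 - |x|^2 is at
  most 3 \<eta> in absolute value, so the well is at most 10 \<eta>^2 and V at most 15
  \<eta>^2.\<close>

lemma conformal_volume_lower_bound:
  assumes V: "near_well \<eta> V" and eta: "0 < \<eta>" "\<eta> \<le> 1"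
  shows "1 / (225 * \<eta> ^ 3) \<le> conformal_volume V"
proof -
  note W = near_wellD[OF V eta(1)]
  define S :: "(real^3) set" where "S = ball 0 (1 + \<eta>) - ball 0 1"
  have S: "measure lborel S = 4 / 3 * pi * ((1 + \<eta>) ^ 3 - 1)"
  proof -
    have "measure lborel S = measure lborel (ball 0 (1 + \<eta>) :: (real^3) set) - measure lborel (ball 0 1 :: (real^3) set)"
      unfolding S_def using eta emeasure_lborel_ball_finite[THEN less_imp_neq]
      by (intro measure_Diff) (auto simp: subset_ball)
    then show ?thesis
      using eta by (simp add: content_ball unit_ball_vol_3 right_diff_distrib)
  qed
  have "1 * \<eta> \<le> (4 * pi) * \<eta>"
    using eta pi_gt3 by (intro mult_right_mono) auto
  also have "\<dots> = 4 / 3 * pi * (3 * \<eta>)" by simp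
  also have "\<dots> \<le> measure lborel S"
    unfolding S using eta by (intro mult_left_mono) (auto simp: eval_nat_numeral algebra_simps)
  finally have meas: "\<eta> \<le> measure lborel S" by simp
  have fin: "emeasure lborel S < \<infinity>"
    by (rule order.strict_trans1[OF emeasure_mono emeasure_lborel_ball_finite[of 0 "1 + \<eta>"]])
       (auto simp: S_def)
  have Sm: "S \<in> sets lborel" by (simp add: S_def)
  have "1 / (225 * \<eta> ^ 4) * \<eta> \<le> 1 / (225 * \<eta> ^ 4) * measure lborel S"
    using meas by (intro mult_left_mono) auto
  also have "\<dots> = (LINT x|lborel. 1 / (225 * \<eta> ^ 4) * indicator S x)"
    using fin Sm by simp
  also have "\<dots> \<le> conformal_volume V"
    unfolding conformal_volume_def
  proof (rule integral_mono)
    show "integrable lborel (\<lambda>x. 1 / (225 * \<eta> ^ 4) * indicator S x :: real)"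
      using fin Sm by (intro integrable_mult_right integrable_real_indicator)
    show "integrable lborel (\<lambda>x::real^3. 1 / (V (x \<bullet> x))\<^sup>2)"
      by (rule integrable_conformal_volume[OF V eta(1)])
    fix x :: "real^3"
    show "1 / (225 * \<eta> ^ 4) * indicator S x \<le> 1 / (V (x \<bullet> x))\<^sup>2"
    proof (cases "x \<in> S")
      case True
      then have x: "1 \<le> norm x" "norm x < 1 + \<eta>" by (auto simp: S_def)
      have "1\<^sup>2 \<le> (norm x)\<^sup>2" "(norm x)\<^sup>2 \<le> (1 + \<eta>)\<^sup>2"
        using x eta by (intro power_mono; simp)+
      then have "1 \<le> x \<bullet> x" "x \<bullet> x \<le> (1 + \<eta>)\<^sup>2"
        unfolding power2_norm_eq_inner by simp_all
      then have "0 \<le> x \<bullet> x - 1" "x \<bullet> x - 1 \<le> 2 * \<eta> + \<eta> * \<eta>"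
        by (simp_all add: power2_eq_square algebra_simps)
      moreover have "\<eta> * \<eta> \<le> \<eta>" using eta by (simp add: mult_left_le)
      ultimately have "\<bar>1 - x \<bullet> x\<bar> \<le> 3 * \<eta>" by linarith
      then have "(1 - x \<bullet> x)\<^sup>2 \<le> (3 * \<eta>)\<^sup>2" using abs_le_square_iff eta(1) by fastforce
      then have "V (x \<bullet> x) \<le> 15 * \<eta>\<^sup>2"
        using W(2)[of "x \<bullet> x"] by (simp add: power_mult_distrib)
      then have "(V (x \<bullet> x))\<^sup>2 \<le> (15 * \<eta>\<^sup>2)\<^sup>2"
        using W(4)[of "x \<bullet> x"] by (intro power_mono) auto
      then have "1 / (225 * \<eta> ^ 4) \<le> 1 / (V (x \<bullet> x))\<^sup>2"
        using W(4)[of "x \<bullet> x"] eta by (intro divide_left_mono) (auto simp: power_mult_distrib)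
      then show ?thesis using True by simp
    qed simp
  qed
  finally show ?thesis using eta by (simp add: eval_nat_numeral field_simps)
qed

section \<open>The contraction\<close>

text \<open>\<open>D\<close> measures distance relative to the well, and W is at least half the
  well, so dividing by W costs a factor 2. The bound 3 is the quotient of 3/2 and 1/2.\<close>

lemma near_well_ratio:
  assumes V: "near_well \<eta> V" and W: "near_well \<eta> W" and eta: "0 < \<eta>"
    and D: "\<And>s. \<bar>V s - W s\<bar> \<le> D * (\<eta>\<^sup>2 + (1 - s)\<^sup>2)"
  shows "\<bar>1 - V s / W s\<bar> \<le> 2 * D" "0 < V s / W s" "V s / W s \<le> 3" "0 \<le> D"
proof -
  note V' = near_wellD[OF V eta, of s] and W' = near_wellD[OF W eta, of s]
  have "0 \<le> D * (\<eta>\<^sup>2 + (1 - s)\<^sup>2)" using D[of s] by linarith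
  then show D0: "0 \<le> D" using V'(3) by (simp add: zero_le_mult_iff)
  have "\<bar>V s - W s\<bar> \<le> D * (2 * W s)"
    using W'(1) by (intro order_trans[OF D[of s] mult_left_mono[OF _ D0]]) simp
  moreover have "\<bar>1 - V s / W s\<bar> = \<bar>V s - W s\<bar> / W s"
    using W'(4) by (simp add: abs_minus_commute divide_simps)
  ultimately show "\<bar>1 - V s / W s\<bar> \<le> 2 * D"
    using W'(4) by (simp add: pos_divide_le_eq)
  show "0 < V s / W s" using V'(4) W'(4) by simp
  show "V s / W s \<le> 3" using V'(2) W'(1,4) by (simp add: pos_divide_le_eq)
qed

text \<open>With r = V/W, 1/V^2 - 1/W^2 = (1 - r) (1 + r) / V^2, where 1 - r is at most 2 D in
  absolute value and 1 + r at most 4.\<close>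

lemma conformal_volume_diff:
  assumes V: "near_well \<eta> V" and W: "near_well \<eta> W" and eta: "0 < \<eta>"
    and D: "\<And>s. \<bar>V s - W s\<bar> \<le> D * (\<eta>\<^sup>2 + (1 - s)\<^sup>2)"
  shows "\<bar>conformal_volume V - conformal_volume W\<bar> \<le> 8 * D * conformal_volume V"
proof -
  note iV = integrable_conformal_volume[OF V eta] and iW = integrable_conformal_volume[OF W eta]
  have pt: "\<bar>1 / (V s)\<^sup>2 - 1 / (W s)\<^sup>2\<bar> \<le> 8 * D * (1 / (V s)\<^sup>2)" for s
  proof -
    note r = near_well_ratio(1-3)[OF V W eta D, of s] near_well_ratio(4)[OF V W eta D]
    have "1 / (V s)\<^sup>2 - 1 / (W s)\<^sup>2 = (1 - (V s / W s)\<^sup>2) * (1 / (V s)\<^sup>2)"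
      using near_wellD(4)[OF V eta, of s] near_wellD(4)[OF W eta, of s] by (simp add: field_simps)
    also have "1 - (V s / W s)\<^sup>2 = (1 - V s / W s) * (1 + V s / W s)"
      by (simp add: power2_eq_square algebra_simps)
    finally have "\<bar>1 / (V s)\<^sup>2 - 1 / (W s)\<^sup>2\<bar>
        = (\<bar>1 - V s / W s\<bar> * \<bar>1 + V s / W s\<bar>) * (1 / (V s)\<^sup>2)"
      by (simp add: abs_mult)
    also have "\<dots> \<le> ((2 * D) * 4) * (1 / (V s)\<^sup>2)"
      using r by (intro mult_right_mono mult_mono) auto
    finally show ?thesis by simp
  qed
  have "conformal_volume V - conformal_volume W = (LINT x::real^3|lborel. 1 / (V (x \<bullet> x))\<^sup>2 - 1 / (W (x \<bullet> x))\<^sup>2)"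
    unfolding conformal_volume_def by (intro Bochner_Integration.integral_diff[symmetric] iV iW)
  also have "\<bar>\<dots>\<bar> \<le> (LINT x::real^3|lborel. \<bar>1 / (V (x \<bullet> x))\<^sup>2 - 1 / (W (x \<bullet> x))\<^sup>2\<bar>)"
    by (rule integral_abs_bound)
  also have "\<dots> \<le> (LINT x::real^3|lborel. 8 * D * (1 / (V (x \<bullet> x))\<^sup>2))"
    by (intro integral_mono integrable_abs Bochner_Integration.integrable_diff integrable_mult_right iV iW pt)
  also have "\<dots> = 8 * D * conformal_volume V"
    unfolding conformal_volume_def by (rule Bochner_Integration.integral_mult_right) (rule iV)
  finally show ?thesis .
qed

text \<open>The coupling \<delta> is the squared quotient, the value for which sqrt(\<delta>) times
  the volume equals \<Lambda>. The constraint is thus built into a nonlocal right-hand side.\<close>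

definition source :: "real \<Rightarrow> (real \<Rightarrow> real) \<Rightarrow> real \<Rightarrow> real" where
  "source \<Lambda> V s = (\<Lambda> / conformal_volume V)\<^sup>2 / V s ^ 3"

lemma continuous_on_source:
  "near_well \<eta> V \<Longrightarrow> 0 < \<eta> \<Longrightarrow> continuous_on UNIV (source \<Lambda> V)"
  unfolding source_def using near_well_continuous[of \<eta> V] near_wellD(4)[of \<eta> V]
  by (intro continuous_intros) (auto simp: less_le)

lemma conformal_volume_pos: "near_well \<eta> V \<Longrightarrow> 0 < \<eta> \<Longrightarrow> \<eta> \<le> 1 \<Longrightarrow> 0 < conformal_volume V"
  by (rule less_le_trans[OF _ conformal_volume_lower_bound[of \<eta> V]]) auto

text \<open>The quotient is the square root of the coupling; squaring it supplies the \<eta>^6 that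
  beats the \<eta>^(-5) in \<open>potential_abs_le\<close>.\<close>

lemma coupling_bound:
  assumes V: "near_well \<eta> V" and eta: "0 < \<eta>" "\<eta> \<le> 1" and L: "0 < \<Lambda>"
  shows "\<Lambda> / conformal_volume V \<le> 225 * \<Lambda> * \<eta> ^ 3"
proof -
  have "\<Lambda> / conformal_volume V \<le> \<Lambda> / (1 / (225 * \<eta> ^ 3))"
    using conformal_volume_lower_bound[OF V eta] conformal_volume_pos[OF V eta] eta L
    by (intro divide_left_mono) auto
  then show ?thesis by (simp add: mult_ac)
qed

lemma inverse_cubed_le:
  assumes V: "near_well \<eta> V" and eta: "0 < \<eta>"
  shows "1 / V s ^ 3 \<le> 8 / (\<eta>\<^sup>2 + (1 - s)\<^sup>2) ^ 3"
proof -
  note V' = near_wellD[OF V eta, of s]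
  have "((\<eta>\<^sup>2 + (1 - s)\<^sup>2) / 2) ^ 3 \<le> V s ^ 3"
    using V' by (intro power_mono) auto
  then have "1 / V s ^ 3 \<le> 1 / ((\<eta>\<^sup>2 + (1 - s)\<^sup>2) / 2) ^ 3"
    using V' by (intro divide_left_mono) auto
  then show ?thesis by (simp add: power_divide)
qed

lemma source_abs_le:
  assumes V: "near_well \<eta> V" and eta: "0 < \<eta>" "\<eta> \<le> 1" and L: "0 < \<Lambda>"
  shows "\<bar>source \<Lambda> V s\<bar> \<le> 8 * (225 * \<Lambda> * \<eta> ^ 3)\<^sup>2 / (\<eta>\<^sup>2 + (1 - s)\<^sup>2) ^ 3"
proof -
  note V' = near_wellD[OF V eta(1), of s]
  have "source \<Lambda> V s = (\<Lambda> / conformal_volume V)\<^sup>2 * (1 / V s ^ 3)"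
    by (simp add: source_def)
  also have "\<dots> \<le> (225 * \<Lambda> * \<eta> ^ 3)\<^sup>2 * (8 / (\<eta>\<^sup>2 + (1 - s)\<^sup>2) ^ 3)"
    using coupling_bound[OF V eta L] inverse_cubed_le[OF V eta(1)] conformal_volume_pos[OF V eta] L V'(4)
    by (intro mult_mono power_mono) auto
  finally have "source \<Lambda> V s \<le> 8 * (225 * \<Lambda> * \<eta> ^ 3)\<^sup>2 / (\<eta>\<^sup>2 + (1 - s)\<^sup>2) ^ 3"
    by (simp add: mult_ac)
  moreover have "0 \<le> source \<Lambda> V s" using V'(4) by (simp add: source_def)
  ultimately show ?thesis by simp
qed

text \<open>The source varies through the coupling and through the cube. These contribute 16 D and
  26 D, and the pointwise bound 8/Q^3 makes 8 (16 + 26) = 336.\<close>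

lemma source_diff:
  assumes V: "near_well \<eta> V" and W: "near_well \<eta> W" and eta: "0 < \<eta>" "\<eta> \<le> 1" and L: "0 < \<Lambda>"
    and D: "\<And>s. \<bar>V s - W s\<bar> \<le> D * (\<eta>\<^sup>2 + (1 - s)\<^sup>2)"
  shows "\<bar>source \<Lambda> V s - source \<Lambda> W s\<bar> \<le> 336 * D * (225 * \<Lambda> * \<eta> ^ 3)\<^sup>2 / (\<eta>\<^sup>2 + (1 - s)\<^sup>2) ^ 3"
proof -
  define a b M B where "a = \<Lambda> / conformal_volume V" and "b = \<Lambda> / conformal_volume W" and "M = 225 * \<Lambda> * \<eta> ^ 3"
    and "B = 8 / (\<eta>\<^sup>2 + (1 - s)\<^sup>2) ^ 3"
  note r = near_well_ratio(1-3)[OF V W eta(1) D, of s] near_well_ratio(4)[OF V W eta(1) D]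
  note vV = conformal_volume_pos[OF V eta] and vW = conformal_volume_pos[OF W eta]
  have a: "0 \<le> a" "a \<le> M" and b: "0 \<le> b" "b \<le> M"
    using coupling_bound[OF V eta L] coupling_bound[OF W eta L] vV vW L
    by (simp_all add: a_def b_def M_def)
  have B: "0 \<le> 1 / V s ^ 3" "1 / V s ^ 3 \<le> B" "0 \<le> 1 / W s ^ 3"  "1 / W s ^ 3 \<le> B"
    using inverse_cubed_le[OF V eta(1)] inverse_cubed_le[OF W eta(1)]
      near_wellD(4)[OF V eta(1), of s] near_wellD(4)[OF W eta(1), of s]
    by (simp_all add: B_def)
  \<comment> \<open>The difference is expressed through the relative error of the volume, which is
    what \<open>conformal_volume_diff\<close> controls.\<close>
  have "a - b = b * ((conformal_volume W - conformal_volume V) / conformal_volume V)"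
    using vV vW by (simp add: a_def b_def field_simps)
  then have "\<bar>a - b\<bar> = b * (\<bar>conformal_volume V - conformal_volume W\<bar> / conformal_volume V)"
    using b(1) vV by (simp add: abs_mult abs_minus_commute)
  also have "\<dots> \<le> M * (8 * D)"
    using conformal_volume_diff[OF V W eta(1) D] vV b by (intro mult_mono) (auto simp: pos_divide_le_eq)
  finally have ab: "\<bar>a - b\<bar> \<le> M * (8 * D)" .
  have "a\<^sup>2 - b\<^sup>2 = (a - b) * (a + b)" by (simp add: power2_eq_square algebra_simps)
  then have "\<bar>a\<^sup>2 - b\<^sup>2\<bar> = \<bar>a - b\<bar> * (a + b)" using a b by (simp add: abs_mult)
  also have "\<dots> \<le> (M * (8 * D)) * (M + M)"
    using ab a b r(4) by (intro mult_mono add_mono) auto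
  finally have sq: "\<bar>a\<^sup>2 - b\<^sup>2\<bar> \<le> 16 * D * M\<^sup>2" by (simp add: power2_eq_square mult_ac)
  define t where "t = V s / W s"
  have t: "\<bar>1 - t\<bar> \<le> 2 * D" "0 < t" "t \<le> 3" using r by (simp_all add: t_def)
  have "1 / V s ^ 3 - 1 / W s ^ 3 = (1 - t ^ 3) * (1 / V s ^ 3)"
    using near_wellD(4)[OF V eta(1), of s] near_wellD(4)[OF W eta(1), of s]
    by (simp add: t_def field_simps)
  also have "1 - t ^ 3 = (1 - t) * (1 + t + t\<^sup>2)"
    by (simp add: power2_eq_square power3_eq_cube algebra_simps)
  finally have "\<bar>1 / V s ^ 3 - 1 / W s ^ 3\<bar> = (\<bar>1 - t\<bar> * (1 + t + t\<^sup>2)) * (1 / V s ^ 3)"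
    using B(1) t(2) by (simp add: abs_mult)
  \<comment> \<open>From t \<le> 3 the quadratic factor is at most 13, whence the constant
    26.\<close>
  also have "\<dots> \<le> ((2 * D) * (1 + 3 + 3\<^sup>2)) * B"
    using t B r(4) by (intro mult_mono add_mono power_mono) auto
  finally have cu: "\<bar>1 / V s ^ 3 - 1 / W s ^ 3\<bar> \<le> 26 * D * B" by simp
  have "source \<Lambda> V s - source \<Lambda> W s
     = (a\<^sup>2 - b\<^sup>2) * (1 / V s ^ 3) + b\<^sup>2 * (1 / V s ^ 3 - 1 / W s ^ 3)"
    by (simp add: source_def a_def b_def algebra_simps)
  also have "\<bar>\<dots>\<bar> \<le> \<bar>a\<^sup>2 - b\<^sup>2\<bar> * (1 / V s ^ 3) + b\<^sup>2 * \<bar>1 / V s ^ 3 - 1 / W s ^ 3\<bar>"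
    using B(1) by (intro order_trans[OF abs_triangle_ineq]) (simp add: abs_mult)
  also have "\<dots> \<le> (16 * D * M\<^sup>2) * B + M\<^sup>2 * (26 * D * B)"
    using sq cu B b r(4) by (intro add_mono mult_mono power_mono) auto
  also have "\<dots> = 336 * D * M\<^sup>2 / (\<eta>\<^sup>2 + (1 - s)\<^sup>2) ^ 3"
    by (simp add: B_def)
  finally show ?thesis by (simp only: M_def)
qed

text \<open>Banach's fixed point theorem on the ball of radius 1/2 of bounded continuous g, with V =
  Q (1 + g). Division by the well Q absorbs the growth at infinity and makes the sup norm the
  relative distance.\<close>

lemma ex_well_solution:
  assumes L: "0 < \<Lambda>"
  shows "\<exists>\<eta> V. 0 < \<eta> \<and> \<eta> \<le> 1 \<and> near_well \<eta> V \<and>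
    (\<forall>s. V s = \<eta>\<^sup>2 + (1 - s)\<^sup>2 + potential (source \<Lambda> V) s)"
proof -
  \<comment> \<open>The product c \<eta> will be the Lipschitz constant, with 336 from
    \<open>source_diff\<close>. The choice of \<eta> gives both c \<eta> \<le> 1/2 and \<eta> \<le>
    1.\<close>
  define c where "c = 336 * (225 * \<Lambda>)\<^sup>2"
  define \<eta> where "\<eta> = 1 / (2 * c + 1)"
  have c: "0 < c" using L by (simp add: c_def)
  have eta: "0 < \<eta>" "\<eta> \<le> 1" and c_eta: "c * \<eta> \<le> 1 / 2"
    using c by (simp_all add: \<eta>_def pos_divide_le_eq)
  have M: "(225 * \<Lambda> * \<eta> ^ 3)\<^sup>2 / \<eta> ^ 5 = (225 * \<Lambda>)\<^sup>2 * \<eta>"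
    using eta by (simp add: power_mult_distrib eval_nat_numeral)
  define Q where "Q = (\<lambda>s::real. \<eta>\<^sup>2 + (1 - s)\<^sup>2)"
  have Q: "0 < Q s" "(1 - s)\<^sup>2 \<le> Q s" for s
    unfolding Q_def using eta by (auto intro: add_pos_nonneg)
  have Qc: "continuous_on UNIV Q" unfolding Q_def by (intro continuous_intros)
  define U where "U = (\<lambda>g s. Q s * (1 + g s :: real))"
  \<comment> \<open>\<open>Bcontfun\<close> is meaningful only on bounded continuous functions, so
    \<open>T\<close> can be unfolded only for g in the ball, as in \<open>T_apply\<close>.\<close>
  define T where "T = (\<lambda>g :: real \<Rightarrow>\<^sub>C real. Bcontfun (\<lambda>s. potential (source \<Lambda> (U g)) s / Q s))"
  have well: "near_well \<eta> (U g)" if "g \<in> cball 0 (1 / 2)" for g :: "real \<Rightarrow>\<^sub>C real"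
  proof -
    have "\<bar>g s\<bar> \<le> 1 / 2" for s
      using norm_bounded[of g s] that by (simp add: dist_norm)
    then have g: "1 / 2 \<le> 1 + g s" "1 + g s \<le> 3 / 2" for s
      using abs_le_iff[of "g s" "1 / 2"] by (smt (verit) field_sum_of_halves)+
    have "Q s / 2 \<le> U g s" "U g s \<le> 3 / 2 * Q s" for s
      using mult_left_mono[OF g(1)[of s] less_imp_le[OF Q(1)[of s]]]
        mult_left_mono[OF g(2)[of s] less_imp_le[OF Q(1)[of s]]]
      by (simp_all add: U_def)
    moreover have "continuous_on UNIV (U g)"
      unfolding U_def by (intro continuous_intros Qc continuous_on_apply_bcontfun)
    ultimately show ?thesis by (simp add: near_well_def Q_def)
  qed
  have source_cont: "continuous_on UNIV (source \<Lambda> (U g))" if "g \<in> cball 0 (1 / 2)" for g :: "real \<Rightarrow>\<^sub>C real"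
    by (rule continuous_on_source[OF well[OF that] eta(1)])
  \<comment> \<open>The linear estimate relative to the well: C = 8 gives invariance of the ball, C
    = 336 \<open>dist g h\<close> the contraction.\<close>
  have small: "\<bar>potential k s / Q s\<bar> \<le> C * (225 * \<Lambda>)\<^sup>2 * \<eta>"
    if "continuous_on UNIV k" "0 \<le> C"
      and "\<And>s. \<bar>k s\<bar> \<le> C * (225 * \<Lambda> * \<eta> ^ 3)\<^sup>2 / (\<eta>\<^sup>2 + (1 - s)\<^sup>2) ^ 3" for k C s
  proof -
    have "\<bar>potential k s\<bar> \<le> C * (225 * \<Lambda> * \<eta> ^ 3)\<^sup>2 / \<eta> ^ 5 * (1 - s)\<^sup>2"
      using that by (intro potential_abs_le eta) auto
    also have "\<dots> = C * (225 * \<Lambda>)\<^sup>2 * \<eta> * (1 - s)\<^sup>2"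
      using M by (simp flip: times_divide_eq_right)
    also have "\<dots> \<le> C * (225 * \<Lambda>)\<^sup>2 * \<eta> * Q s"
      using that(2) eta Q(2) by (intro mult_left_mono) auto
    finally show ?thesis using Q(1)[of s] by (simp add: pos_divide_le_eq)
  qed
  have T_le: "\<bar>potential (source \<Lambda> (U g)) s / Q s\<bar> \<le> 1 / 2" if g: "g \<in> cball 0 (1 / 2)" for g :: "real \<Rightarrow>\<^sub>C real" and s
  proof -
    have "\<bar>potential (source \<Lambda> (U g)) s / Q s\<bar> \<le> 8 * (225 * \<Lambda>)\<^sup>2 * \<eta>"
      by (intro small source_cont[OF g] source_abs_le[OF well[OF g] eta L]) simp
    also have "\<dots> \<le> c * \<eta>" unfolding c_def using eta by (intro mult_right_mono) auto
    finally show ?thesis using c_eta by linarith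
  qed
  have T_apply: "T g s = potential (source \<Lambda> (U g)) s / Q s" if g: "g \<in> cball 0 (1 / 2)" for g s
  proof -
    have "continuous_on UNIV (\<lambda>s. potential (source \<Lambda> (U g)) s / Q s)"
      using Q(1) by (intro continuous_on_divide continuous_on_potential source_cont[OF g] Qc) (auto simp: less_le)
    then have "(\<lambda>s. potential (source \<Lambda> (U g)) s / Q s) \<in> bcontfun"
      using T_le[OF g] by (intro bcontfun_normI[where b = "1 / 2"]) auto
    then show ?thesis by (simp add: T_def Bcontfun_inverse)
  qed
  have "\<exists>!g. g \<in> cball 0 (1 / 2) \<and> T g = g"
  proof (rule Banach_fix[of _ "1 / 2"])
    show "complete (cball (0 :: real \<Rightarrow>\<^sub>C real) (1 / 2))"
      by (simp add: complete_eq_closed)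
    show "T ` cball 0 (1 / 2) \<subseteq> cball 0 (1 / 2)"
    proof
      fix h assume "h \<in> T ` cball 0 (1 / 2)"
      then obtain g where g: "g \<in> cball 0 (1 / 2)" and h: "h = T g" by blast
      have "norm (T g) \<le> 1 / 2"
        using T_le[OF g] by (intro norm_bound) (simp add: T_apply[OF g])
      then show "h \<in> cball 0 (1 / 2)" by (simp add: h)
    qed
    fix g h :: "real \<Rightarrow>\<^sub>C real" assume g: "g \<in> cball 0 (1 / 2)" and h: "h \<in> cball 0 (1 / 2)"
    have D: "\<bar>U g s - U h s\<bar> \<le> dist g h * (\<eta>\<^sup>2 + (1 - s)\<^sup>2)" for s
    proof -
      have "\<bar>U g s - U h s\<bar> = \<bar>g s - h s\<bar> * Q s"
        using Q(1)[of s] by (simp add: U_def right_diff_distrib[symmetric] abs_mult mult.commute)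
      also have "\<dots> \<le> dist g h * Q s"
        using dist_bounded[of g s h] Q(1)[of s] by (intro mult_right_mono) (auto simp: dist_real_def)
      finally show ?thesis by (simp add: Q_def)
    qed
    show "dist (T g) (T h) \<le> 1 / 2 * dist g h"
    proof (rule dist_bound)
      fix s
      have "dist (T g s) (T h s) = \<bar>potential (\<lambda>s. source \<Lambda> (U g) s - source \<Lambda> (U h) s) s / Q s\<bar>"
        by (simp add: T_apply[OF g] T_apply[OF h] dist_real_def potential_diff[OF source_cont[OF g] source_cont[OF h]] diff_divide_distrib)
      also have "\<dots> \<le> (336 * dist g h) * (225 * \<Lambda>)\<^sup>2 * \<eta>"
        by (intro small continuous_on_diff source_cont g h source_diff well eta L D) simp
      also have "\<dots> = c * \<eta> * dist g h" by (simp add: c_def)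
      also have "\<dots> \<le> 1 / 2 * dist g h" using c_eta by (intro mult_right_mono) auto
      finally show "dist (T g s) (T h s) \<le> 1 / 2 * dist g h" .
    qed
  qed auto
  then obtain g where g: "g \<in> cball 0 (1 / 2)" and fix_g: "T g = g" by blast
  have "U g s = \<eta>\<^sup>2 + (1 - s)\<^sup>2 + potential (source \<Lambda> (U g)) s" for s
  proof -
    have "U g s = Q s + Q s * g s" by (simp add: U_def distrib_left)
    also have "Q s * g s = potential (source \<Lambda> (U g)) s"
      using T_apply[OF g, of s] Q(1)[of s] by (simp add: fix_g)
    finally show "U g s = \<eta>\<^sup>2 + (1 - s)\<^sup>2 + potential (source \<Lambda> (U g)) s"
      by (simp add: Q_def)
  qed
  then show ?thesis using eta well[OF g] by blast
qed

section \<open>The solution\<close>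

text \<open>The radial formula 4 s F'' + 6 F' becomes 2 s \<open>radial_mean 4 G'\<close> + 3
  \<open>radial_mean 2 G\<close>, which is G. The factor c carries the final rescaling.\<close>

lemma laplacian_radial_mean:
  fixes F G G' :: "real \<Rightarrow> real"
  assumes F: "\<And>s. (F has_real_derivative 1 / 2 * radial_mean 2 G s) (at s)"
    and G: "\<And>s. (G has_real_derivative G' s) (at s)" and G': "continuous_on UNIV G'"
  shows "laplacian (\<lambda>x::real^3. c * F (x \<bullet> x)) = (\<lambda>x. c * G (x \<bullet> x))"
proof
  fix x :: "real^3"
  have "laplacian (\<lambda>x::real^3. c * F (x \<bullet> x)) x
      = 4 * (x \<bullet> x) * (c * (1 / 2 * radial_mean 4 G' (x \<bullet> x)))
        + 2 * DIM(real^3) * (c * (1 / 2 * radial_mean 2 G (x \<bullet> x)))"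
  proof (rule laplacian_radial)
    show "((\<lambda>s. c * F s) has_real_derivative c * (1 / 2 * radial_mean 2 G s)) (at s)" for s
      by (intro DERIV_cmult F)
    show "((\<lambda>s. c * (1 / 2 * radial_mean 2 G s)) has_real_derivative c * (1 / 2 * radial_mean 4 G' s)) (at s)" for s
      using radial_mean_has_derivative[OF G G', of 2 s] by (intro DERIV_cmult) simp
  qed
  also have "\<dots> = c * (2 * (x \<bullet> x) * radial_mean 4 G' (x \<bullet> x) + 3 * radial_mean 2 G (x \<bullet> x))"
    by (simp add: algebra_simps)
  also have "\<dots> = c * G (x \<bullet> x)"
    by (simp only: radial_mean_laplacian[OF G G'])
  finally show "laplacian (\<lambda>x::real^3. c * F (x \<bullet> x)) x = c * G (x \<bullet> x)" .
qed

section \<open>From the integral equation to a smooth solution of the sixth-order equation\<close>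

locale well_solution =
  fixes \<Lambda> \<eta> :: real and V :: "real \<Rightarrow> real"
  assumes eta_pos: "0 < \<eta>" and well: "near_well \<eta> V"
    and V: "V s = \<eta>\<^sup>2 + (1 - s)\<^sup>2 + potential (source \<Lambda> V) s"
begin

definition k :: "real \<Rightarrow> real" where "k = source \<Lambda> V"
text \<open>\<open>w\<close> and \<open>p\<close> are layers of \<open>potential\<close>: the second
  Laplacian and the second s-derivative of the correction. If F' is half of
  \<open>radial_mean 2 Z\<close> and Z' half of \<open>radial_mean 2 w\<close>, then F'' has exactly
  the form of \<open>p\<close>.\<close>

definition w :: "real \<Rightarrow> real" where "w = (\<lambda>y. - 1 / 2 * radial_mean 0 (primitive 0 k) y)"
definition p :: "real \<Rightarrow> real" where "p = (\<lambda>s. 1 / 4 * radial_mean 4 (radial_mean 2 w) s)"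
definition V' :: "real \<Rightarrow> real" where "V' = (\<lambda>s. 2 * (s - 1) + primitive 1 p s)"

lemma V_pos: "0 < V s"
  by (rule near_wellD(4)[OF well eta_pos])

lemma continuous_k: "continuous_on UNIV k"
  unfolding k_def by (rule continuous_on_source[OF well eta_pos])

lemma continuous_w: "continuous_on UNIV w"
  unfolding w_def by (intro continuous_on_potential_parts continuous_k)

lemma continuous_p: "continuous_on UNIV p"
  unfolding p_def by (intro continuous_on_potential_parts continuous_w)

lemma V_deriv: "(V has_real_derivative V' s) (at s)"
proof -
  have "V = (\<lambda>s. \<eta>\<^sup>2 + (1 - s)\<^sup>2 + primitive 1 (primitive 1 p) s)"
    using V by (intro ext) (simp add: potential_def k_def w_def p_def)
  moreover have "((\<lambda>s. \<eta>\<^sup>2 + (1 - s)\<^sup>2 + primitive 1 (primitive 1 p) s) has_real_derivative V' s) (at s)"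
    by (auto intro!: derivative_eq_intros primitive_has_derivative continuous_on_primitive continuous_p
        simp: V'_def)
  ultimately show ?thesis by simp
qed

lemma V'_deriv: "(V' has_real_derivative 2 + p s) (at s)"
  unfolding V'_def
  by (auto intro!: derivative_eq_intros primitive_has_derivative continuous_p)

lemma w_deriv: "(w has_real_derivative - 1 / 2 * radial_mean 2 k s) (at s)"
proof -
  have "(radial_mean 0 (primitive 0 k) has_real_derivative radial_mean (0 + 2) k s) (at s)"
    by (intro radial_mean_has_derivative primitive_has_derivative continuous_k)
  then show ?thesis unfolding w_def by (intro DERIV_cmult) (simp only: add_0)
qed

text \<open>Bootstrap: if V is C^n, then so are k, w and p, hence V', and V is C^(n+1). Positivity
  of V keeps 1/V^3 regular.\<close>

lemma Ck_V: "Ck n V" and Ck_k: "Ck n k"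
proof -
  have k: "Ck n k" if "Ck n V" for n
  proof -
    have "Ck n (\<lambda>s. (\<Lambda> / conformal_volume V)\<^sup>2 * inverse (V s) ^ 3)"
      by (intro Ck_mult Ck_const Ck_power Ck_inverse that) (use V_pos in \<open>simp add: less_imp_neq[symmetric]\<close>)
    moreover have "k = (\<lambda>s. (\<Lambda> / conformal_volume V)\<^sup>2 * inverse (V s) ^ 3)"
      by (intro ext) (simp add: k_def source_def field_simps)
    ultimately show ?thesis by simp
  qed
  show Ck_V: "Ck n V" for n
  proof (induction n)
    case 0
    then show ?case by (simp add: near_well_continuous[OF well])
  next
    case (Suc n)
    have "Ck (Suc n) w"
      by (intro Ck_Suc_realI[OF w_deriv] Ck_mult Ck_const Ck_radial_mean k Suc.IH)
    then have "Ck n w" by (rule Ck_SucD)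
    then have "Ck n p"
      unfolding p_def by (intro Ck_mult Ck_const Ck_radial_mean)
    then have "Ck (Suc n) V'"
      by (intro Ck_Suc_realI[OF V'_deriv] Ck_add Ck_const)
    then have "Ck n V'" by (rule Ck_SucD)
    then show ?case by (rule Ck_Suc_realI[OF V_deriv])
  qed
  show "Ck n k" by (intro k Ck_V)
qed

text \<open>
  \<open>Z\<close> and \<open>W\<close> are the first and second Laplacian of \<open>V\<close>. The constant is \<open>\<Delta>\<^sup>2 (1 - \<bar>x\<bar>\<^sup>2)\<^sup>2 = 120\<close>, and
  the shift in \<open>Z\<close> makes \<open>radial_mean 2 Z\<close> vanish at \<open>s = 1\<close>, as \<open>V'\<close> does.
\<close>
definition W :: "real \<Rightarrow> real" where "W = (\<lambda>s. w s - - 120)"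
definition Z1 :: "real \<Rightarrow> real" where "Z1 = primitive 1 (\<lambda>s. 1 / 2 * radial_mean 2 W s)"
definition Z :: "real \<Rightarrow> real" where "Z = (\<lambda>s. Z1 s - 3 * radial_mean 2 Z1 1)"

text \<open>The factor -1 stays inside the mean so that \<open>laplacian_radial_mean\<close> applies
  with G = -k.\<close>

lemma W_deriv: "(W has_real_derivative 1 / 2 * radial_mean 2 (\<lambda>s. - 1 * k s) s) (at s)"
  unfolding W_def radial_mean_cmult using w_deriv[of s]
  by (auto intro!: derivative_eq_intros)

lemma continuous_W: "continuous_on UNIV W"
  by (rule has_real_derivative_continuous_on[OF W_deriv])

lemma continuous_mean_W: "continuous_on UNIV (\<lambda>s. 1 / 2 * radial_mean 2 W s)"
  by (intro continuous_on_potential_parts continuous_W)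

lemma Z1_deriv: "(Z1 has_real_derivative 1 / 2 * radial_mean 2 W s) (at s)"
  unfolding Z1_def by (intro primitive_has_derivative continuous_mean_W)

lemma Z_deriv: "(Z has_real_derivative 1 / 2 * radial_mean 2 W s) (at s)"
  unfolding Z_def using Z1_deriv[of s] by (auto intro!: derivative_eq_intros)

text \<open>Both sides have derivative 2 + p and vanish at s = 1: the left one since its primitive
  is based there, the right one by the shift in \<open>Z\<close>.\<close>

lemma V'_eq: "V' s = 1 / 2 * radial_mean 2 Z s"
proof -
  have "(radial_mean 2 Z has_real_derivative radial_mean 4 (\<lambda>s. 1 / 2 * radial_mean 2 W s) s) (at s)" for s
    using radial_mean_has_derivative[OF Z_deriv continuous_mean_W, of 2 s] by simp
  moreover have "radial_mean 4 (\<lambda>s. 1 / 2 * radial_mean 2 W s) s = 2 * (2 + p s)" for s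
  proof -
    \<comment> \<open>The constant 120 averages to 120/3 = 40 and then to 40/5 = 8, whose half is
      twice the second derivative 2 of (1 - s)^2. Subtracting a negative number fits
      \<open>radial_mean_diff\<close>.\<close>
    have "radial_mean 2 W = (\<lambda>s. radial_mean 2 w s - - 40)"
      unfolding W_def
      by (intro ext, subst radial_mean_diff) (auto intro: continuous_w simp: radial_mean_const)
    then have "radial_mean 4 (radial_mean 2 W) s = radial_mean 4 (radial_mean 2 w) s - - 8"
      by (simp only:, subst radial_mean_diff)
         (auto intro: continuous_on_radial_mean continuous_w simp: radial_mean_const)
    then show ?thesis by (simp only: radial_mean_cmult) (simp add: p_def)
  qed
  ultimately have "((\<lambda>s. V' s - 1 / 2 * radial_mean 2 Z s) has_real_derivative 0) (at s)" for s
    using V'_deriv[of s] by (auto intro!: derivative_eq_intros)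
  then have "V' s - 1 / 2 * radial_mean 2 Z s = V' 1 - 1 / 2 * radial_mean 2 Z 1"
    by (intro DERIV_isconst_all allI)
  \<comment> \<open>The weight t^2 averages a constant to a third of it, which the factor 3 in
    \<open>Z\<close> undoes.\<close>
  moreover have "radial_mean 2 Z 1 = 0"
    unfolding Z_def
    by (subst radial_mean_diff)
       (auto intro: has_real_derivative_continuous_on[OF Z1_deriv] simp: radial_mean_const)
  moreover have "V' 1 = 0" by (simp add: V'_def)
  ultimately show ?thesis by simp
qed

text \<open>Three applications of \<open>laplacian_radial_mean\<close> lead from V to Z, from Z to W
  and from W to -k.\<close>

lemma laplacian_cubed:
  "laplacian (laplacian (laplacian (\<lambda>x::real^3. c * V (x \<bullet> x)))) = (\<lambda>x. - (c * k (x \<bullet> x)))"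
proof -
  have "laplacian (\<lambda>x::real^3. c * V (x \<bullet> x)) = (\<lambda>x. c * Z (x \<bullet> x))"
    using V_deriv unfolding V'_eq by (rule laplacian_radial_mean[OF _ Z_deriv continuous_mean_W])
  moreover have "laplacian (\<lambda>x::real^3. c * Z (x \<bullet> x)) = (\<lambda>x. c * W (x \<bullet> x))"
  proof (rule laplacian_radial_mean[OF Z_deriv W_deriv])
    show "continuous_on UNIV (\<lambda>s. 1 / 2 * radial_mean 2 (\<lambda>s. - 1 * k s) s)"
      by (intro continuous_on_potential_parts continuous_k)
  qed
  moreover have "laplacian (\<lambda>x::real^3. c * W (x \<bullet> x)) = (\<lambda>x. c * (- 1 * k (x \<bullet> x)))"
  proof -
    \<comment> \<open>The last application needs a continuous derivative of k, available from the
      bootstrap.\<close>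
    have "Ck (Suc 0) (\<lambda>s. - 1 * k s)" by (intro Ck_mult Ck_const Ck_k)
    then obtain G' where G': "\<forall>s. ((\<lambda>s. - 1 * k s) has_real_derivative G' s) (at s)" "Ck 0 G'"
      using Ck_Suc_has_real_derivative by blast
    then show ?thesis
      by (intro laplacian_radial_mean[OF W_deriv, of G']) auto
  qed
  ultimately show ?thesis by simp
qed

end

theorem theorem2:
  fixes \<Lambda> :: real
  assumes "\<Lambda> > 0"
  shows "\<exists>u :: real^3 \<Rightarrow> real.
           smooth u \<and> (\<forall>x. u x > 0) \<and> radial u \<and>
           (\<forall>x. laplacian (laplacian (laplacian u)) x = - 1 / (u x) ^ 3) \<and>
           ((\<lambda>x. 1 / (u x) ^ 2) has_integral \<Lambda>) UNIV"
proof -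
  obtain \<eta> V where eta: "0 < \<eta>" "\<eta> \<le> 1" and well: "near_well \<eta> V"
    and V: "\<And>s. V s = \<eta>\<^sup>2 + (1 - s)\<^sup>2 + potential (source \<Lambda> V) s"
    using ex_well_solution[OF assms] by blast
  interpret well_solution \<Lambda> \<eta> V
    by unfold_locales (use eta well V in auto)
  define J where "J = conformal_volume V"
  have J: "0 < J" unfolding J_def by (rule conformal_volume_pos[OF well eta])
  \<comment> \<open>Passing to u = c V divides the integral J by c^2, which gives \<Lambda>. The
    same c satisfies c^4 (\<Lambda>/J)^2 = 1, so the coupling in the equation becomes 1.\<close>
  define c where "c = sqrt (J / \<Lambda>)"
  have c: "0 < c" "c\<^sup>2 = J / \<Lambda>" using J assms by (simp_all add: c_def)
  define u where "u = (\<lambda>x::real^3. c * V (x \<bullet> x))"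
  show ?thesis
  proof (intro exI[of _ u] conjI allI)
    show "smooth u"
      unfolding smooth_def u_def by (intro allI Ck_mult Ck_const Ck_radial Ck_V)
    show "0 < u x" for x
      unfolding u_def using c(1) V_pos by simp
    show "radial u"
      unfolding radial_def u_def by (simp add: norm_eq_sqrt_inner)
    show "laplacian (laplacian (laplacian u)) x = - 1 / (u x) ^ 3" for x
    proof -
      have "c ^ 4 * (\<Lambda> / J)\<^sup>2 = (c\<^sup>2 * (\<Lambda> / J))\<^sup>2" by (simp add: power_mult_distrib power_divide)
      also have "\<dots> = 1" unfolding c(2) using J assms by simp
      finally have "c * (\<Lambda> / J)\<^sup>2 = 1 / c ^ 3"
        using c(1) J assms by (simp add: eval_nat_numeral field_simps)
      then have "c * k (x \<bullet> x) = 1 / (u x) ^ 3"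
        by (simp add: u_def k_def source_def power_mult_distrib J_def[symmetric])
      then show ?thesis unfolding u_def laplacian_cubed by simp
    qed
    have "((\<lambda>x::real^3. 1 / (V (x \<bullet> x))\<^sup>2) has_integral J) UNIV"
      unfolding J_def conformal_volume_def by (rule has_integral_integral_lborel[OF integrable_conformal_volume[OF well eta(1)]])
    then have "((\<lambda>x::real^3. \<Lambda> / J * (1 / (V (x \<bullet> x))\<^sup>2)) has_integral \<Lambda> / J * J) UNIV"
      by (rule has_integral_mult_right)
    moreover have "(\<lambda>x. \<Lambda> / J * (1 / (V (x \<bullet> x))\<^sup>2)) = (\<lambda>x. 1 / (u x)\<^sup>2)"
      using c J assms by (auto simp: u_def power_mult_distrib)
    ultimately show "((\<lambda>x. 1 / (u x)\<^sup>2) has_integral \<Lambda>) UNIV"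
      using J by simp
  qed
qed

end
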